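(* Let $(Q,\sqsubseteq,\otimes,\mathbb{1})$ be a continuous quantale and let $d:X\times X\to Q$ be a $Q$-metric on a set $X$. Let $\mathsf{C}(Q)$ be the set of Scott closed subsets of $Q$, ordered by inclusion, with tensor $A_1\otimes_{\mathsf{C}}A_2=\overline{\{q_1\otimes q_2 : q_1\in A_1,\ q_2\in A_2\}}$ (closure in the Scott topology of $Q$) and unit ${\downarrow}\mathbb{1}=\{q: q\sqsubseteq\mathbb{1}\}$; this is a continuous quantale. Define $d_S:\mathsf{P}(X)\times\mathsf{P}(X)\to\mathsf{C}(Q)$ by $$d_S(A_1,A_2)=\bigcap_{x_2\in A_2}\overline{\{d(x_1,x_2): x_1\in A_1\}}$$ (closure in the Scott topology of $Q$); $d_S$ is a $\mathsf{C}(Q)$-metric on $\mathsf{P}(X)$. Then the robust topology $\tau_{d,R}$ on $\mathsf{P}(X)$ coincides with the open ball topology $\tau_{d_S}$ of $(\mathsf{P}(X),d_S,\mathsf{C}(Q))$.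
   Context: A quantale $(Q,\sqsubseteq,\otimes,\mathbb{1})$ is a complete lattice $(Q,\sqsubseteq)$ with a monoid structure $(Q,\otimes,\mathbb{1})$ such that $x\otimes\bigsqcup S=\bigsqcup\{x\otimes y:y\in S\}$ and $(\bigsqcup S)\otimes x=\bigsqcup\{y\otimes x: y\in S\}$ for all $x\in Q$, $S\subseteq Q$. In a complete lattice, $x\ll y$ (way-below) means: for every directed $D\subseteq Q$, $y\sqsubseteq\bigsqcup D$ implies $x\sqsubseteq d$ for some $d\in D$. A quantale is continuous if its lattice is continuous, i.e. $y=\bigsqcup\{x: x\ll y\}$ for all $y$. A $Q$-metric on a set $X$ is a map $d:X\times X\to Q$ with $d(x,y)\otimes d(y,z)\sqsubseteq d(x,z)$ and $\mathbb{1}\sqsubseteq d(x,x)$ for all $x,y,z$ (no symmetry or separation required). For a $Q$-metric $d$ with $Q$ continuous, the open ball with center $x$ and radius $\delta\ll\mathbb{1}$ is $B(x,\delta)=\{y\in X:\delta\ll d(x,y)\}$, and the open ball topology $\tau_d$ is the topology on $X$ generated by all open balls. For $A\subseteq X$ and $\delta\ll\mathbb{1}$, let $B_R(A,\delta)=\bigcup_{x\in A}B(x,\delta)$. The robust topology $\tau_{d,R}$ on the powerset $\mathsf{P}(X)$ is: $U\in\tau_{d,R}$ iff for every $A\in U$ there is $\delta\ll\mathbb{1}$ with $\mathsf{P}(B_R(A,\delta))\subseteq U$. The open ball topology $\tau_{d_S}$ is defined in the same way using the quantale $\mathsf{C}(Q)$ (with its own way-below relation and unit ${\downarrow}\mathbb{1}$).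 *)

theory Defs
  imports "HOL-Analysis.Abstract_Topology"
begin

definition (in order) directed :: "'a set \<Rightarrow> bool" where
  "directed D \<longleftrightarrow> D \<noteq> {} \<and> (\<forall>x\<in>D. \<forall>y\<in>D. \<exists>z\<in>D. x \<le> z \<and> y \<le> z)"

lemma directedD: "directed D \<Longrightarrow> a \<in> D \<Longrightarrow> b \<in> D \<Longrightarrow> \<exists>c\<in>D. a \<le> c \<and> b \<le> c"
  by (simp add: directed_def)

definition (in complete_lattice) way_below :: "'a \<Rightarrow> 'a \<Rightarrow> bool" (infix "\<lless>" 50) where
  "x \<lless> y \<longleftrightarrow> (\<forall>D. directed D \<longrightarrow> y \<le> Sup D \<longrightarrow> (\<exists>d\<in>D. x \<le> d))"

definition scott_open :: "'a::complete_lattice set \<Rightarrow> bool" where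
  "scott_open U \<longleftrightarrow> (\<forall>x\<in>U. \<forall>y. x \<le> y \<longrightarrow> y \<in> U) \<and>
     (\<forall>D. directed D \<longrightarrow> Sup D \<in> U \<longrightarrow> D \<inter> U \<noteq> {})"

definition scott_topology :: "'a::complete_lattice topology" where
  "scott_topology = topology scott_open"

abbreviation scott_closure :: "'a::complete_lattice set \<Rightarrow> 'a set" where
  "scott_closure S \<equiv> scott_topology closure_of S"

lemma istopology_scott_open: "istopology scott_open"
  unfolding istopology_def
proof (intro conjI allI impI)
  fix S T :: "'a set" assume S: "scott_open S" and T: "scott_open T"
  have up: "y \<in> S \<inter> T" if "x \<in> S" "x \<le> y" "x' \<in> T" "x' \<le> y" for x x' y
    using S T that unfolding scott_open_def by (meson IntI)
  show "scott_open (S \<inter> T)"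
    unfolding scott_open_def
  proof (intro conjI allI impI ballI)
    fix x y assume "x \<in> S \<inter> T" "x \<le> y"
    then show "y \<in> S \<inter> T" using up by (meson IntE)
  next
    fix D :: "'a set" assume D: "directed D" and s: "Sup D \<in> S \<inter> T"
    have "D \<inter> S \<noteq> {}" "D \<inter> T \<noteq> {}"
      using S T D s by (simp_all add: scott_open_def)
    then obtain a b where ab: "a \<in> D" "a \<in> S" "b \<in> D" "b \<in> T" by auto
    obtain c where c: "c \<in> D" "a \<le> c" "b \<le> c"
      using directedD[OF D ab(1,3)] by blast
    have "c \<in> D \<inter> (S \<inter> T)" using c(1) up[OF ab(2) c(2) ab(4) c(3)] by (rule IntI)
    then show "D \<inter> (S \<inter> T) \<noteq> {}" by (metis emptyE)
  qed
next
  fix K :: "'a set set" assume "\<forall>S\<in>K. scott_open S"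
  then have K: "scott_open S" if "S \<in> K" for S using that by (rule bspec)
  have up: "y \<in> S" if "S \<in> K" "x \<in> S" "x \<le> y" for S x y
    using K[OF that(1)] that(2,3) unfolding scott_open_def by meson
  have meets: "D \<inter> S \<noteq> {}" if "S \<in> K" "directed D" "Sup D \<in> S" for S D
    using K[OF that(1)] that(2,3) unfolding scott_open_def by meson
  show "scott_open (\<Union>K)"
    unfolding scott_open_def
  proof (intro conjI allI impI ballI)
    show "y \<in> \<Union>K" if "x \<in> \<Union>K" "x \<le> y" for x y
      using that up by (meson UnionE UnionI)
    show "D \<inter> \<Union>K \<noteq> {}" if D: "directed D" "Sup D \<in> \<Union>K" for D
    proof -
      obtain S where "S \<in> K" "Sup D \<in> S" using D(2) by (rule UnionE)
      then show ?thesis using meets[OF _ D(1)] by auto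
    qed
  qed
qed

lemma openin_scott_topology: "openin scott_topology U \<longleftrightarrow> scott_open U"
  by (simp add: scott_topology_def istopology_scott_open)

lemma topspace_scott_topology [simp]: "topspace scott_topology = UNIV"
proof -
  have "scott_open (UNIV :: 'a set)"
    by (auto simp: scott_open_def directed_def)
  then show ?thesis
    by (metis openin_scott_topology openin_subset top.extremum_uniqueI)
qed

lemma closedin_scott_topology:
  "closedin scott_topology A \<longleftrightarrow>
     (\<forall>x\<in>A. \<forall>y. y \<le> x \<longrightarrow> y \<in> A) \<and> (\<forall>D. directed D \<longrightarrow> D \<subseteq> A \<longrightarrow> Sup D \<in> A)"
  unfolding closedin_def openin_scott_topology scott_open_def by auto

lemma scott_closure_closed [simp]: "closedin scott_topology (scott_closure S)"
  by simp

lemma scott_closure_subset: "S \<subseteq> scott_closure S"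
  by (simp add: closure_of_subset)

lemma scott_closure_minimal:
  "S \<subseteq> A \<Longrightarrow> closedin scott_topology A \<Longrightarrow> scott_closure S \<subseteq> A"
  by (rule closure_of_minimal)

lemma scott_closed_downset:
  "closedin scott_topology A \<Longrightarrow> x \<in> A \<Longrightarrow> y \<le> x \<Longrightarrow> y \<in> A"
  unfolding closedin_scott_topology by blast

lemma scott_closed_Sup:
  "closedin scott_topology A \<Longrightarrow> directed D \<Longrightarrow> D \<subseteq> A \<Longrightarrow> Sup D \<in> A"
  by (simp add: closedin_scott_topology)

lemma closedin_scott_Inter:
  assumes "\<And>A. A \<in> K \<Longrightarrow> closedin scott_topology A"
  shows "closedin scott_topology (\<Inter>K)"
proof (cases "K = {}")
  case True
  then show ?thesis using closedin_topspace[of scott_topology] by simp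
next
  case False
  then show ?thesis using assms by (rule closedin_Inter)
qed

lemma closedin_scott_atMost: "closedin scott_topology {..q}"
  unfolding closedin_scott_topology by (auto intro: Sup_least)

lemma way_below_imp_le: "x \<lless> y \<Longrightarrow> x \<le> y"
  unfolding way_below_def directed_def by (elim allE[of _ "{y}"]) auto

lemma way_below_trans_le: "x' \<le> x \<Longrightarrow> x \<lless> y \<Longrightarrow> y \<le> y' \<Longrightarrow> x' \<lless> y'"
  unfolding way_below_def by (meson order_trans)

lemma way_below_le_trans: "x \<lless> y \<Longrightarrow> y \<le> y' \<Longrightarrow> x \<lless> y'"
  by (rule way_below_trans_le[OF order.refl])

lemma le_way_below_trans: "x' \<le> x \<Longrightarrow> x \<lless> y \<Longrightarrow> x' \<lless> y"
  by (rule way_below_trans_le[OF _ _ order.refl])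

lemma bot_way_below: "bot \<lless> y"
  unfolding way_below_def directed_def by auto

lemma way_belowD: "x \<lless> y \<Longrightarrow> directed D \<Longrightarrow> y \<le> Sup D \<Longrightarrow> \<exists>d\<in>D. x \<le> d"
  by (simp add: way_below_def)

lemma sup_way_below:
  assumes "x \<lless> z" "y \<lless> z"
  shows "sup x y \<lless> z"
  unfolding way_below_def
proof (intro allI impI)
  fix D assume D: "directed D" "z \<le> Sup D"
  obtain a where a: "a \<in> D" "x \<le> a" using way_belowD[OF assms(1) D] by (rule bexE)
  obtain b where b: "b \<in> D" "y \<le> b" using way_belowD[OF assms(2) D] by (rule bexE)
  obtain c where c: "c \<in> D" "a \<le> c" "b \<le> c"
    using directedD[OF D(1) a(1) b(1)] by blast
  have "sup x y \<le> c" using a(2) b(2) c(2,3) by (simp add: order_trans)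
  with c(1) show "\<exists>d\<in>D. sup x y \<le> d" by (rule bexI[rotated])
qed

class quantale = complete_lattice + monoid_mult +
  assumes mult_Sup: "x * Sup S = (SUP y\<in>S. x * y)"
    and Sup_mult: "Sup S * x = (SUP y\<in>S. y * x)"

class continuous_quantale = quantale +
  assumes continuous: "y = Sup {x. x \<lless> y}"

lemma quantale_mult_right_mono: "y \<le> y' \<Longrightarrow> x * y \<le> x * (y' :: 'q::quantale)"
  using mult_Sup[of x "{y, y'}"] by (simp add: sup_absorb2 le_iff_sup)

lemma quantale_mult_left_mono: "y \<le> y' \<Longrightarrow> y * x \<le> y' * (x :: 'q::quantale)"
  using Sup_mult[of "{y, y'}" x] by (simp add: sup_absorb2 le_iff_sup)

lemma directed_image_mono:
  assumes "directed D" "\<And>x y. x \<le> y \<Longrightarrow> f x \<le> f y"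
  shows "directed (f ` D)"
  using assms unfolding directed_def by simp meson

lemma closedin_scott_vimage_left:
  fixes y :: "'q::quantale"
  assumes "closedin scott_topology C"
  shows "closedin scott_topology {x. x * y \<in> C}"
  unfolding closedin_scott_topology
proof (intro conjI ballI allI impI)
  fix a b assume "a \<in> {x. x * y \<in> C}" "b \<le> a"
  then show "b \<in> {x. x * y \<in> C}"
    using scott_closed_downset[OF assms] quantale_mult_left_mono by blast
next
  fix D assume D: "directed D" "D \<subseteq> {x. x * y \<in> C}"
  have "directed ((\<lambda>x. x * y) ` D)"
    using D(1) by (rule directed_image_mono) (rule quantale_mult_left_mono)
  then have "(SUP x\<in>D. x * y) \<in> C"
    using assms D(2) unfolding closedin_scott_topology by blast
  then show "Sup D \<in> {x. x * y \<in> C}" by (simp add: Sup_mult)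
qed

lemma closedin_scott_vimage_right:
  fixes y :: "'q::quantale"
  assumes "closedin scott_topology C"
  shows "closedin scott_topology {x. y * x \<in> C}"
  unfolding closedin_scott_topology
proof (intro conjI ballI allI impI)
  fix a b assume "a \<in> {x. y * x \<in> C}" "b \<le> a"
  then show "b \<in> {x. y * x \<in> C}"
    using scott_closed_downset[OF assms] quantale_mult_right_mono by blast
next
  fix D assume D: "directed D" "D \<subseteq> {x. y * x \<in> C}"
  have "directed ((\<lambda>x. y * x) ` D)"
    using D(1) by (rule directed_image_mono) (rule quantale_mult_right_mono)
  then have "(SUP x\<in>D. y * x) \<in> C"
    using assms D(2) unfolding closedin_scott_topology by blast
  then show "Sup D \<in> {x. y * x \<in> C}" by (simp add: mult_Sup)
qed

lemma scott_closure_mult_in: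
  fixes A B C :: "'q::quantale set"
  assumes C: "closedin scott_topology C" and "\<And>a b. a \<in> A \<Longrightarrow> b \<in> B \<Longrightarrow> a * b \<in> C"
    and "x \<in> scott_closure A" "y \<in> scott_closure B"
  shows "x * y \<in> C"
proof -
  have "x * b \<in> C" if "b \<in> B" for b
    using scott_closure_minimal[OF _ closedin_scott_vimage_left[OF C], of A b] assms that by blast
  then show ?thesis
    using scott_closure_minimal[OF _ closedin_scott_vimage_right[OF C], of B x] assms by blast
qed

lemma way_below_interpolate:
  fixes x y :: "'q::continuous_quantale"
  assumes "x \<lless> y"
  shows "\<exists>z. x \<lless> z \<and> z \<lless> y"
proof -
  let ?D = "{w. \<exists>z. w \<lless> z \<and> z \<lless> y}"
  have "directed ?D"
    unfolding directed_def
  proof (intro conjI ballI)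
    have "bot \<in> ?D" using bot_way_below by auto
    then show "?D \<noteq> {}" by (metis emptyE)
    fix a b assume "a \<in> ?D" "b \<in> ?D"
    then obtain a' b' where a': "a \<lless> a'" "a' \<lless> y" and b': "b \<lless> b'" "b' \<lless> y" by auto
    have "a \<lless> sup a' b'" "b \<lless> sup a' b'"
      using way_below_le_trans[OF a'(1) sup_ge1] way_below_le_trans[OF b'(1) sup_ge2] by simp_all
    then have "sup a b \<lless> sup a' b'" by (rule sup_way_below)
    moreover have "sup a' b' \<lless> y" using a'(2) b'(2) by (rule sup_way_below)
    ultimately have "sup a b \<in> ?D" by auto
    then show "\<exists>z\<in>?D. a \<le> z \<and> b \<le> z" by (rule bexI[rotated]) simp
  qed
  moreover have "y \<le> Sup ?D"
  proof -
    have "z \<le> Sup ?D" if "z \<lless> y" for z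
    proof -
      have "Sup {w. w \<lless> z} \<le> Sup ?D"
        using that by (intro Sup_subset_mono) auto
      then show ?thesis by (simp flip: continuous)
    qed
    then have "Sup {z. z \<lless> y} \<le> Sup ?D" by (intro Sup_least) auto
    then show ?thesis by (simp flip: continuous)
  qed
  ultimately have "\<exists>w\<in>?D. x \<le> w" by (rule way_belowD[OF assms])
  then obtain w where w: "w \<in> ?D" "x \<le> w" by (rule bexE)
  then obtain z where z: "w \<lless> z" "z \<lless> y" by auto
  have "x \<lless> z" using w(2) z(1) by (rule le_way_below_trans)
  with z(2) show ?thesis by auto
qed

lemma directed_way_below: "directed {x. x \<lless> a}"
  unfolding directed_def
proof (intro conjI ballI)
  have "bot \<in> {x. x \<lless> a}" by (simp add: bot_way_below)
  then show "{x. x \<lless> a} \<noteq> {}" by (metis emptyE)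
  fix x y assume "x \<in> {x. x \<lless> a}" "y \<in> {x. x \<lless> a}"
  then have "sup x y \<in> {x. x \<lless> a}" by (simp add: sup_way_below)
  then show "\<exists>z\<in>{x. x \<lless> a}. x \<le> z \<and> y \<le> z" by (rule bexI[rotated]) simp
qed

lemma scott_open_way_above:
  fixes x :: "'q::continuous_quantale"
  shows "scott_open {y. x \<lless> y}"
  unfolding scott_open_def
proof (intro conjI ballI allI impI)
  fix a b assume "a \<in> {y. x \<lless> y}" "a \<le> b"
  then show "b \<in> {y. x \<lless> y}" using way_below_le_trans[of x a b] by simp
next
  fix D :: "'q set" assume D: "directed D" "Sup D \<in> {y. x \<lless> y}"
  obtain z where z: "x \<lless> z" "z \<lless> Sup D" using D(2) way_below_interpolate[of x "Sup D"] by auto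
  obtain d where d: "d \<in> D" "z \<le> d" using way_belowD[OF z(2) D(1) order.refl] by auto
  have "d \<in> D \<inter> {y. x \<lless> y}" using d(1) way_below_le_trans[OF z(1) d(2)] by simp
  then show "D \<inter> {y. x \<lless> y} \<noteq> {}" by (metis emptyE)
qed

text \<open>The empty set is Scott closed, since directed sets are nonempty; it is the bottom element.\<close>

typedef (overloaded) 'q scott_closed = "{A :: 'q::complete_lattice set. closedin scott_topology A}"
  morphisms set_of Abs_scott_closed
  by (rule exI[of _ "{}"]) simp

setup_lifting type_definition_scott_closed

instantiation scott_closed :: (complete_lattice) complete_lattice
begin

lift_definition less_eq_scott_closed :: "'a scott_closed \<Rightarrow> 'a scott_closed \<Rightarrow> bool" is "(\<subseteq>)" .
lift_definition less_scott_closed :: "'a scott_closed \<Rightarrow> 'a scott_closed \<Rightarrow> bool" is "(\<subset>)" .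
lift_definition inf_scott_closed :: "'a scott_closed \<Rightarrow> 'a scott_closed \<Rightarrow> 'a scott_closed" is "(\<inter>)"
  by (rule closedin_Int)
lift_definition sup_scott_closed :: "'a scott_closed \<Rightarrow> 'a scott_closed \<Rightarrow> 'a scott_closed" is "(\<union>)"
  by (rule closedin_Un)
lift_definition bot_scott_closed :: "'a scott_closed" is "{}" by simp
lift_definition top_scott_closed :: "'a scott_closed" is "UNIV"
  by (metis closedin_topspace topspace_scott_topology)
lift_definition Inf_scott_closed :: "'a scott_closed set \<Rightarrow> 'a scott_closed" is "\<lambda>K. \<Inter>K"
  by (rule closedin_scott_Inter)
lift_definition Sup_scott_closed :: "'a scott_closed set \<Rightarrow> 'a scott_closed"
  is "\<lambda>K. scott_closure (\<Union>K)"
  by simp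

instance
proof
  fix K :: "'a scott_closed set" and x :: "'a scott_closed"
  show "x \<in> K \<Longrightarrow> Inf K \<le> x" by transfer auto
  show "(\<And>y. y \<in> K \<Longrightarrow> x \<le> y) \<Longrightarrow> x \<le> Inf K" by transfer auto
  show "x \<in> K \<Longrightarrow> x \<le> Sup K" by transfer (meson Sup_upper order_trans scott_closure_subset)
  show "(\<And>y. y \<in> K \<Longrightarrow> y \<le> x) \<Longrightarrow> Sup K \<le> x"
    by transfer (simp add: Sup_least scott_closure_minimal)
  show "Inf {} = (top :: 'a scott_closed)" by transfer simp
  show "Sup {} = (bot :: 'a scott_closed)" by transfer simp
qed (transfer; auto)+

end

instantiation scott_closed :: (quantale) quantale
begin

lift_definition one_scott_closed :: "'a scott_closed" is "{q. q \<le> 1}"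
  using closedin_scott_atMost[of 1] by (simp add: atMost_def)

lift_definition times_scott_closed :: "'a scott_closed \<Rightarrow> 'a scott_closed \<Rightarrow> 'a scott_closed"
  is "\<lambda>A\<^sub>1 A\<^sub>2. scott_closure {q\<^sub>1 * q\<^sub>2 | q\<^sub>1 q\<^sub>2. q\<^sub>1 \<in> A\<^sub>1 \<and> q\<^sub>2 \<in> A\<^sub>2}"
  by simp

lemma times_scott_closed_le_iff:
  "A * B \<le> (C :: 'a scott_closed) \<longleftrightarrow> (\<forall>a\<in>set_of A. \<forall>b\<in>set_of B. a * b \<in> set_of C)"
  apply transfer
  subgoal for A B C
    using scott_closure_subset[of "{q\<^sub>1 * q\<^sub>2 | q\<^sub>1 q\<^sub>2. q\<^sub>1 \<in> A \<and> q\<^sub>2 \<in> B}"]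
      scott_closure_minimal[of "{q\<^sub>1 * q\<^sub>2 | q\<^sub>1 q\<^sub>2. q\<^sub>1 \<in> A \<and> q\<^sub>2 \<in> B}" C]
    by blast
  done

lemma times_scott_closed_memI:
  "a \<in> set_of A \<Longrightarrow> b \<in> set_of B \<Longrightarrow> a * b \<in> set_of (A * B :: 'a scott_closed)"
  using times_scott_closed_le_iff[of A B "A * B"] by blast

instance
proof
  fix A B C :: "'a scott_closed" and K :: "'a scott_closed set"
  have closed: "closedin scott_topology (set_of X)" for X :: "'a scott_closed"
    using set_of by auto
  have times: "set_of (X * Y) =
      scott_closure {q\<^sub>1 * q\<^sub>2 | q\<^sub>1 q\<^sub>2. q\<^sub>1 \<in> set_of X \<and> q\<^sub>2 \<in> set_of Y}" for X Y :: "'a scott_closed"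
    by transfer simp
  have cl: "x \<in> scott_closure (set_of X)" if "x \<in> set_of X" for x and X :: "'a scott_closed"
    using scott_closure_subset that by (rule subsetD)
  have le: "x \<in> set_of Y" if "X \<le> Y" "x \<in> set_of X" for x and X Y :: "'a scott_closed"
    using that by (auto simp: less_eq_scott_closed.rep_eq)
  show "A * B * C = A * (B * C)"
  proof (rule order.antisym)
    show "A * B * C \<le> A * (B * C)"
      unfolding times_scott_closed_le_iff
    proof (intro ballI)
      fix x c assume x: "x \<in> set_of (A * B)" and c: "c \<in> set_of C"
      show "x * c \<in> set_of (A * (B * C))"
        apply (rule scott_closure_mult_in[OF closed _ x[unfolded times] cl[OF c]])
        apply clarify
        apply (subst mult.assoc)
        apply (intro times_scott_closed_memI)
        apply assumption+
        done
    qed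
    show "A * (B * C) \<le> A * B * C"
      unfolding times_scott_closed_le_iff
    proof (intro ballI)
      fix x a assume x: "x \<in> set_of (B * C)" and a: "a \<in> set_of A"
      show "a * x \<in> set_of (A * B * C)"
        apply (rule scott_closure_mult_in[OF closed _ cl[OF a] x[unfolded times]])
        apply clarify
        apply (subst mult.assoc[symmetric])
        apply (intro times_scott_closed_memI)
        apply assumption+
        done
    qed
  qed
  have one: "q \<in> set_of (1 :: 'a scott_closed) \<longleftrightarrow> q \<le> 1" for q :: 'a
    by transfer simp
  show "1 * A = A"
  proof (rule order.antisym)
    have "a * b \<in> set_of A" if "a \<in> set_of 1" "b \<in> set_of A" for a b
      using quantale_mult_left_mono[of a 1 b] that one
      by (intro scott_closed_downset[OF closed that(2)]) simp
    then show "1 * A \<le> A" unfolding times_scott_closed_le_iff by (intro ballI)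
    have "a \<in> set_of (1 * A)" if "a \<in> set_of A" for a
      using times_scott_closed_memI[of 1 1 a A] that by (simp add: one)
    then show "A \<le> 1 * A" by (simp add: less_eq_scott_closed.rep_eq subsetI)
  qed
  show "A * 1 = A"
  proof (rule order.antisym)
    have "b * a \<in> set_of A" if "b \<in> set_of A" "a \<in> set_of 1" for a b
      using quantale_mult_right_mono[of a 1 b] that one
      by (intro scott_closed_downset[OF closed that(1)]) simp
    then show "A * 1 \<le> A" unfolding times_scott_closed_le_iff by (intro ballI)
    have "a \<in> set_of (A * 1)" if "a \<in> set_of A" for a
      using times_scott_closed_memI[of a A 1 1] that by (simp add: one)
    then show "A \<le> A * 1" by (simp add: less_eq_scott_closed.rep_eq subsetI)
  qed
  have mono: "X * Y \<le> X' * Y'" if "X \<le> X'" "Y \<le> Y'" for X X' Y Y' :: "'a scott_closed"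
    unfolding times_scott_closed_le_iff
    using le[OF that(1)] le[OF that(2)] by (intro ballI times_scott_closed_memI)
  have Sup: "set_of (Sup K) = scott_closure (\<Union>(set_of ` K))"
    by (simp add: Sup_scott_closed.rep_eq)
  show "A * Sup K = (SUP B\<in>K. A * B)"
  proof (rule order.antisym)
    show "A * Sup K \<le> (SUP B\<in>K. A * B)"
      unfolding times_scott_closed_le_iff
    proof (intro ballI)
      fix a x assume a: "a \<in> set_of A" and x: "x \<in> set_of (Sup K)"
      show "a * x \<in> set_of (SUP B\<in>K. A * B)"
        apply (rule scott_closure_mult_in[OF closed _ cl[OF a] x[unfolded Sup]])
        apply (elim UnionE imageE)
        apply (rule le[OF SUP_upper], assumption)
        apply (rule times_scott_closed_memI; simp)
        done
    qed
    show "(SUP B\<in>K. A * B) \<le> A * Sup K"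
      by (intro SUP_least mono Sup_upper order.refl)
  qed
  show "Sup K * A = (SUP B\<in>K. B * A)"
  proof (rule order.antisym)
    show "Sup K * A \<le> (SUP B\<in>K. B * A)"
      unfolding times_scott_closed_le_iff
    proof (intro ballI)
      fix a x assume a: "a \<in> set_of A" and x: "x \<in> set_of (Sup K)"
      show "x * a \<in> set_of (SUP B\<in>K. B * A)"
        apply (rule scott_closure_mult_in[OF closed _ x[unfolded Sup] cl[OF a]])
        apply (elim UnionE imageE)
        apply (rule le[OF SUP_upper], assumption)
        apply (rule times_scott_closed_memI; simp)
        done
    qed
    show "(SUP B\<in>K. B * A) \<le> Sup K * A"
      by (intro SUP_least mono Sup_upper order.refl)
  qed
qed

end

instance scott_closed :: (continuous_quantale) continuous_quantale
proof
  fix A :: "'a scott_closed"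
  define dn where "dn q = Abs_scott_closed {..q}" for q :: 'a
  have dn: "set_of (dn q) = {..q}" for q
    unfolding dn_def by (simp add: Abs_scott_closed_inverse closedin_scott_atMost)
  have closed: "closedin scott_topology (set_of X)" for X :: "'a scott_closed"
    using set_of by auto
  have wb: "dn x \<lless> A" if a: "a \<in> set_of A" and x: "x \<lless> a" for x a
    unfolding way_below_def
  proof (intro allI impI)
    fix D assume "directed D" and "A \<le> Sup D"
    then have "a \<in> scott_closure (\<Union>(set_of ` D))"
      using a by (auto simp: less_eq_scott_closed.rep_eq Sup_scott_closed.rep_eq)
    moreover have "openin scott_topology {y. x \<lless> y}"
      by (simp add: openin_scott_topology scott_open_way_above)
    ultimately have "\<exists>y\<in>\<Union>(set_of ` D). y \<in> {y. x \<lless> y}"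
      using x by (auto simp: in_closure_of dest!: spec[of _ "{y. x \<lless> y}"])
    then obtain y B where y: "x \<lless> y" "y \<in> set_of B" "B \<in> D" by auto
    have "{..x} \<subseteq> set_of B"
    proof
      fix z assume "z \<in> {..x}"
      then have "z \<le> y" using way_below_imp_le[OF y(1)] by (simp add: order_trans)
      then show "z \<in> set_of B" by (rule scott_closed_downset[OF closed y(2)])
    qed
    then have "dn x \<le> B" by (simp add: less_eq_scott_closed.rep_eq dn)
    then show "\<exists>B\<in>D. dn x \<le> B" using y(3) by (rule bexI)
  qed
  show "A = Sup {B. B \<lless> A}"
  proof (rule order.antisym)
    let ?S = "set_of (Sup {B. B \<lless> A})"
    have "a \<in> ?S" if "a \<in> set_of A" for a
    proof -
      have "{x. x \<lless> a} \<subseteq> ?S"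
      proof
        fix x assume "x \<in> {x. x \<lless> a}"
        then have "dn x \<le> Sup {B. B \<lless> A}" using wb[OF that] by (simp add: Sup_upper)
        then show "x \<in> ?S" by (auto simp: less_eq_scott_closed.rep_eq dn)
      qed
      then have "Sup {x. x \<lless> a} \<in> ?S"
        by (rule scott_closed_Sup[OF closed directed_way_below])
      then show ?thesis by (simp flip: continuous)
    qed
    then show "A \<le> Sup {B. B \<lless> A}" by (simp add: less_eq_scott_closed.rep_eq subsetI)
    show "Sup {B. B \<lless> A} \<le> A" by (auto intro: Sup_least way_below_imp_le)
  qed
qed

text \<open>
  The quantale is a type and the underlying set of a metric space is an explicit carrier, possibly
  empty; only the values of \<open>d\<close> on the carrier matter.
\<close>

definition quantale_metric_on :: "'x set \<Rightarrow> ('x \<Rightarrow> 'x \<Rightarrow> 'q::quantale) \<Rightarrow> bool" where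
  "quantale_metric_on X d \<longleftrightarrow>
     (\<forall>x\<in>X. \<forall>y\<in>X. \<forall>z\<in>X. d x y * d y z \<le> d x z) \<and> (\<forall>x\<in>X. 1 \<le> d x x)"

definition open_ball :: "'x set \<Rightarrow> ('x \<Rightarrow> 'x \<Rightarrow> 'q::continuous_quantale) \<Rightarrow> 'x \<Rightarrow> 'q \<Rightarrow> 'x set" where
  "open_ball X d x \<delta> = {y\<in>X. \<delta> \<lless> d x y}"

definition open_ball_topology :: "'x set \<Rightarrow> ('x \<Rightarrow> 'x \<Rightarrow> 'q::continuous_quantale) \<Rightarrow> 'x topology" where
  "open_ball_topology X d = topology_generated_by {open_ball X d x \<delta> | x \<delta>. x \<in> X \<and> \<delta> \<lless> 1}"

definition robust_ball :: "'x set \<Rightarrow> ('x \<Rightarrow> 'x \<Rightarrow> 'q::continuous_quantale) \<Rightarrow> 'x set \<Rightarrow> 'q \<Rightarrow> 'x set" where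
  "robust_ball X d A \<delta> = (\<Union>x\<in>A. open_ball X d x \<delta>)"

definition robust_open :: "'x set \<Rightarrow> ('x \<Rightarrow> 'x \<Rightarrow> 'q::continuous_quantale) \<Rightarrow> 'x set set \<Rightarrow> bool" where
  "robust_open X d U \<longleftrightarrow> U \<subseteq> Pow X \<and> (\<forall>A\<in>U. \<exists>\<delta>. \<delta> \<lless> 1 \<and> Pow (robust_ball X d A \<delta>) \<subseteq> U)"

definition robust_topology :: "'x set \<Rightarrow> ('x \<Rightarrow> 'x \<Rightarrow> 'q::continuous_quantale) \<Rightarrow> 'x set topology" where
  "robust_topology X d = topology (robust_open X d)"

text \<open>
  An empty second argument yields the intersection over no sets, which is the top element
  \<^term>\<open>UNIV\<close>.
\<close>

lift_definition scott_hausdorff ::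
  "('x \<Rightarrow> 'x \<Rightarrow> 'q::continuous_quantale) \<Rightarrow> 'x set \<Rightarrow> 'x set \<Rightarrow> 'q scott_closed"
  is "\<lambda>d A\<^sub>1 A\<^sub>2. \<Inter>x\<^sub>2\<in>A\<^sub>2. scott_closure {d x\<^sub>1 x\<^sub>2 | x\<^sub>1. x\<^sub>1 \<in> A\<^sub>1}"
  by (rule closedin_scott_Inter) auto

lemma topspace_open_ball_topology: "topspace (open_ball_topology X d) = X"
proof -
  have "X \<subseteq> \<Union>{open_ball X d x \<delta> | x \<delta>. x \<in> X \<and> \<delta> \<lless> 1}"
  proof
    fix x assume x: "x \<in> X"
    then have "x \<in> open_ball X d x bot" by (simp add: open_ball_def bot_way_below)
    moreover have "open_ball X d x bot \<in> {open_ball X d x \<delta> | x \<delta>. x \<in> X \<and> \<delta> \<lless> 1}"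
      using x bot_way_below by auto
    ultimately show "x \<in> \<Union>{open_ball X d x \<delta> | x \<delta>. x \<in> X \<and> \<delta> \<lless> 1}" by (rule UnionI[rotated])
  qed
  moreover have "\<Union>{open_ball X d x \<delta> | x \<delta>. x \<in> X \<and> \<delta> \<lless> 1} \<subseteq> X"
    by (auto simp: open_ball_def)
  ultimately show ?thesis
    unfolding open_ball_topology_def topology_generated_by_topspace by (rule subset_antisym[rotated])
qed

lemma robust_ball_mono:
  assumes "\<delta> \<le> \<epsilon>"
  shows "robust_ball X d A \<epsilon> \<subseteq> robust_ball X d A \<delta>"
  using le_way_below_trans[OF assms] by (auto simp: robust_ball_def open_ball_def)

lemma istopology_robust_open: "istopology (robust_open X d)"
  unfolding istopology_def
proof (intro conjI allI impI)
  fix S T assume S: "robust_open X d S" and T: "robust_open X d T"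
  have "\<exists>\<delta>. \<delta> \<lless> 1 \<and> Pow (robust_ball X d A \<delta>) \<subseteq> S \<inter> T" if A: "A \<in> S \<inter> T" for A
  proof -
    obtain \<delta> where \<delta>: "\<delta> \<lless> 1" "Pow (robust_ball X d A \<delta>) \<subseteq> S"
      using S A unfolding robust_open_def by auto
    obtain \<epsilon> where \<epsilon>: "\<epsilon> \<lless> 1" "Pow (robust_ball X d A \<epsilon>) \<subseteq> T"
      using T A unfolding robust_open_def by auto
    have "Pow (robust_ball X d A (sup \<delta> \<epsilon>)) \<subseteq> S \<inter> T"
      using Pow_mono[OF robust_ball_mono[OF sup_ge1]] Pow_mono[OF robust_ball_mono[OF sup_ge2]] \<delta>(2) \<epsilon>(2)
      by (meson Int_greatest subset_trans)
    moreover have "sup \<delta> \<epsilon> \<lless> 1" using \<delta>(1) \<epsilon>(1) by (rule sup_way_below)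
    ultimately show ?thesis by auto
  qed
  moreover have "S \<inter> T \<subseteq> Pow X" using S unfolding robust_open_def by auto
  ultimately show "robust_open X d (S \<inter> T)" unfolding robust_open_def by simp
next
  fix K assume K: "\<forall>S\<in>K. robust_open X d S"
  have "\<exists>\<delta>. \<delta> \<lless> 1 \<and> Pow (robust_ball X d A \<delta>) \<subseteq> \<Union>K" if A: "A \<in> S" and S: "S \<in> K" for A S
  proof -
    obtain \<delta> where "\<delta> \<lless> 1" "Pow (robust_ball X d A \<delta>) \<subseteq> S"
      using bspec[OF K S] A unfolding robust_open_def by auto
    then show ?thesis using Union_upper[OF S] by (meson subset_trans)
  qed
  moreover have "\<Union>K \<subseteq> Pow X" using K unfolding robust_open_def by (intro Union_least) simp
  ultimately show "robust_open X d (\<Union>K)" unfolding robust_open_def by (auto simp del: Union_iff elim!: UnionE)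
qed

lemma openin_robust_topology: "openin (robust_topology X d) U \<longleftrightarrow> robust_open X d U"
  by (simp add: robust_topology_def istopology_robust_open)

lemma quantale_metric_on_scott_hausdorff:
  assumes d: "quantale_metric_on X d"
  shows "quantale_metric_on (Pow X) (scott_hausdorff d)"
  unfolding quantale_metric_on_def
proof (intro conjI ballI)
  fix A B C assume ABC: "A \<in> Pow X" "B \<in> Pow X" "C \<in> Pow X"
  show "scott_hausdorff d A B * scott_hausdorff d B C \<le> scott_hausdorff d A C"
    unfolding times_scott_closed_le_iff
  proof (intro ballI)
    fix q r assume q: "q \<in> set_of (scott_hausdorff d A B)" and r: "r \<in> set_of (scott_hausdorff d B C)"
    have "q * r \<in> scott_closure {d a c | a. a \<in> A}" (is "_ \<in> ?C") if c: "c \<in> C" for c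
    proof (rule scott_closure_mult_in[of _ "{q}" "{d b c | b. b \<in> B}"])
      show "r \<in> scott_closure {d b c | b. b \<in> B}"
        using r c by (auto simp: scott_hausdorff.rep_eq)
      show "q \<in> scott_closure {q}" using scott_closure_subset[of "{q}"] by simp
      fix q' s assume "q' \<in> {q}" "s \<in> {d b c | b. b \<in> B}"
      then obtain b where b: "b \<in> B" "s = d b c" "q' = q" by blast
      have "q * d b c \<in> ?C"
      proof (rule scott_closure_mult_in[of _ "{d a b | a. a \<in> A}" "{d b c}"])
        show "q \<in> scott_closure {d a b | a. a \<in> A}"
          using q b by (auto simp: scott_hausdorff.rep_eq)
        show "d b c \<in> scott_closure {d b c}" using scott_closure_subset[of "{d b c}"] by simp
        fix u v assume "u \<in> {d a b | a. a \<in> A}" "v \<in> {d b c}"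
        then obtain a where a: "a \<in> A" "u = d a b" "v = d b c" by blast
        then have "u * v \<le> d a c"
          using d ABC b c unfolding quantale_metric_on_def by blast
        moreover have "d a c \<in> ?C"
          using scott_closure_subset[of "{d a c | a. a \<in> A}"] a(1) by blast
        ultimately show "u * v \<in> ?C" using scott_closed_downset[OF scott_closure_closed] by blast
      qed simp
      then show "q' * s \<in> ?C" using b by simp
    qed simp
    then show "q * r \<in> set_of (scott_hausdorff d A C)"
      by (simp add: scott_hausdorff.rep_eq)
  qed
next
  fix A assume A: "A \<in> Pow X"
  have "q \<in> scott_closure {d a x | a. a \<in> A}" if "x \<in> A" "q \<le> 1" for x q
  proof -
    have "d x x \<in> scott_closure {d a x | a. a \<in> A}"
      using scott_closure_subset[of "{d a x | a. a \<in> A}"] that by blast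
    moreover have "q \<le> d x x"
      using d A that unfolding quantale_metric_on_def by (meson PowD order_trans subsetD)
    ultimately show ?thesis using scott_closed_downset[OF scott_closure_closed] by blast
  qed
  then show "1 \<le> scott_hausdorff d A A"
    by (auto simp: less_eq_scott_closed.rep_eq one_scott_closed.rep_eq scott_hausdorff.rep_eq)
qed

end

(* Both topologies have, at every set, neighbourhood bases that interleave. For e << 1 the principal
   ideal below e is way below the unit of C(Q), and these ideals are cofinal among the elements
   way below the unit. Moreover e lies in d_S(A, B) as soon as B is contained in the robust ball of
   radius e around A, while conversely e in d_S(A, B) puts B into the robust ball of any radius
   way below e, because the set of elements above such a radius is Scott open. *)
theory Submission
  imports Defs
begin

lift_definition principal :: "'q::complete_lattice \<Rightarrow> 'q scott_closed" is "\<lambda>q. {..q}"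
  by (rule closedin_scott_atMost)

lemma closedin_set_of: "closedin scott_topology (set_of A)"
  using set_of by auto

text \<open>Scott closed sets are downward closed. This turns membership in them into an inequality
  of C(Q), the form in which way-below can be applied.\<close>

lemma principal_le_iff: "principal q \<le> A \<longleftrightarrow> q \<in> set_of A"
  using scott_closed_downset[OF closedin_set_of[of A]]
  by (auto simp: less_eq_scott_closed.rep_eq principal.rep_eq)

text \<open>By interpolation, the elements way above \<open>p\<close> form a Scott open set; it is a
  neighbourhood of \<open>q\<close>, so it meets every set whose closure contains
  \<open>q\<close>.\<close>

lemma scott_closure_meets_way_above:
  fixes q :: "'q::continuous_quantale"
  assumes "q \<in> scott_closure S" "p \<lless> q"
  shows "\<exists>s\<in>S. p \<lless> s"
proof -
  have "openin scott_topology {y. p \<lless> y}"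
    by (simp add: openin_scott_topology scott_open_way_above)
  then show ?thesis
    using assms by (auto simp: in_closure_of dest!: spec[of _ "{y. p \<lless> y}"])
qed

text \<open>Suprema in C(Q) are closures of unions, so some member of \<open>D\<close> already
  contains an element way above \<open>p\<close>, hence \<open>p\<close> itself.\<close>

lemma principal_way_below:
  fixes p q :: "'q::continuous_quantale"
  assumes q: "q \<in> set_of A" and p: "p \<lless> q"
  shows "principal p \<lless> A"
  unfolding way_below_def
proof (intro allI impI)
  fix D :: "'q scott_closed set" assume "A \<le> Sup D"
  then have "q \<in> scott_closure (\<Union>(set_of ` D))"
    using q by (auto simp: less_eq_scott_closed.rep_eq Sup_scott_closed.rep_eq)
  then obtain s B where sB: "p \<lless> s" "s \<in> set_of B" "B \<in> D"
    using scott_closure_meets_way_above[OF _ p] by blast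
  then have "p \<in> set_of B"
    using scott_closed_downset[OF closedin_set_of] way_below_imp_le by blast
  then show "\<exists>B\<in>D. principal p \<le> B"
    using sB(3) by (auto simp: principal_le_iff)
qed

text \<open>The ideals \<open>principal e\<close> with \<open>e \<lless> 1\<close> form a directed
  family whose supremum lies above the unit, so one of them lies above \<open>E\<close>.\<close>

lemma way_below_one_scott_closed:
  fixes E :: "'q::continuous_quantale scott_closed"
  assumes "E \<lless> 1"
  shows "\<exists>e. e \<lless> 1 \<and> E \<le> principal e"
proof -
  let ?D = "principal ` {e. e \<lless> (1::'q)}"
  have dir: "directed ?D"
    by (rule directed_image_mono[OF directed_way_below])
      (auto simp: less_eq_scott_closed.rep_eq principal.rep_eq)
  have "{e. e \<lless> (1::'q)} \<subseteq> set_of (Sup ?D)"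
  proof
    fix e :: 'q assume "e \<in> {e. e \<lless> 1}"
    then have "principal e \<le> Sup ?D" by (intro Sup_upper imageI)
    then show "e \<in> set_of (Sup ?D)" by (simp add: principal_le_iff)
  qed
  \<comment> \<open>Scott closed sets contain suprema of their directed subsets; by continuity this
    one is \<open>1\<close>.\<close>
  then have "Sup {e. e \<lless> (1::'q)} \<in> set_of (Sup ?D)"
    by (rule scott_closed_Sup[OF closedin_set_of directed_way_below])
  then have "(1::'q) \<in> set_of (Sup ?D)"
    by (simp flip: continuous)
  then have "principal (1::'q) \<le> Sup ?D"
    by (simp add: principal_le_iff)
  moreover have "principal (1::'q) = 1"
    by transfer (simp add: atMost_def)
  ultimately have "1 \<le> Sup ?D" by simp
  from way_belowD[OF assms dir this] show ?thesis by auto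
qed

lemma center_in_open_ball:
  assumes "quantale_metric_on X d" "x \<in> X" "\<delta> \<lless> 1"
  shows "x \<in> open_ball X d x \<delta>"
  using assms way_below_le_trans[of \<delta> 1 "d x x"]
  by (simp add: open_ball_def quantale_metric_on_def)

text \<open>Each point of a ball is the centre of a smaller one, by the triangle inequality. For
  \<open>scott_hausdorff\<close> this is what makes balls robust open at every member, not only at
  their centre.\<close>

lemma open_ball_subset_open_ball:
  fixes d :: "'x \<Rightarrow> 'x \<Rightarrow> 'q::continuous_quantale"
  assumes d: "quantale_metric_on X d" and x: "x \<in> X" and y: "y \<in> open_ball X d x \<delta>"
  shows "\<exists>\<epsilon>. \<epsilon> \<lless> 1 \<and> open_ball X d y \<epsilon> \<subseteq> open_ball X d x \<delta>"
proof -
  have yX: "y \<in> X" and "\<delta> \<lless> d x y" using y by (auto simp: open_ball_def)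
  \<comment> \<open>The triangle inequality only yields \<open>\<eta> \<le> d x z\<close>; the gap
    between \<open>\<delta>\<close> and \<open>\<eta>\<close> restores way-below.\<close>
  then obtain \<eta> where \<eta>: "\<delta> \<lless> \<eta>" "\<eta> \<lless> d x y" using way_below_interpolate by blast
  let ?D = "(\<lambda>e. d x y * e) ` {e. e \<lless> 1}"
  have dir: "directed ?D"
    using directed_way_below by (rule directed_image_mono) (rule quantale_mult_right_mono)
  \<comment> \<open>Multiplication preserves suprema and \<open>1\<close> is the supremum of the
    elements way below it, so \<open>Sup ?D\<close> is \<open>d x y\<close>.\<close>
  have "Sup ?D = d x y * Sup {e. e \<lless> 1}" by (simp add: mult_Sup)
  then have "d x y \<le> Sup ?D" by (simp flip: continuous)
  from way_belowD[OF \<eta>(2) dir this] obtain \<epsilon> where \<epsilon>: "\<epsilon> \<lless> 1" "\<eta> \<le> d x y * \<epsilon>" by auto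
  have "z \<in> open_ball X d x \<delta>" if z: "z \<in> open_ball X d y \<epsilon>" for z
  proof -
    have zX: "z \<in> X" and "\<epsilon> \<le> d y z"
      using z by (auto simp: open_ball_def intro: way_below_imp_le)
    then have "d x y * \<epsilon> \<le> d x y * d y z" by (intro quantale_mult_right_mono)
    also have "\<dots> \<le> d x z" using d x yX zX by (simp add: quantale_metric_on_def)
    finally have "\<eta> \<le> d x z" using \<epsilon>(2) by (rule order_trans[rotated])
    then show ?thesis using way_below_le_trans[OF \<eta>(1)] zX by (simp add: open_ball_def)
  qed
  with \<epsilon>(1) show ?thesis by blast
qed

lemma Pow_robust_ball_subset_open_ball:
  assumes "E \<lless> 1"
  shows "\<exists>\<delta>. \<delta> \<lless> 1 \<and>
    Pow (robust_ball X d A \<delta>) \<subseteq> open_ball (Pow X) (scott_hausdorff d) A E"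
proof -
  \<comment> \<open>Only \<open>principal \<delta> \<le> scott_hausdorff d A B\<close> will be
    available below; \<open>E \<lless> F\<close> makes up for the lost strictness.\<close>
  obtain F where F: "E \<lless> F" "F \<lless> 1" using way_below_interpolate[OF assms] by blast
  obtain \<delta> where \<delta>: "\<delta> \<lless> 1" "F \<le> principal \<delta>" using way_below_one_scott_closed[OF F(2)] by blast
  have "B \<in> open_ball (Pow X) (scott_hausdorff d) A E" if B: "B \<subseteq> robust_ball X d A \<delta>" for B
  proof -
    have "\<delta> \<in> scott_closure {d a b | a. a \<in> A}" if b: "b \<in> B" for b
    proof -
      obtain a where "a \<in> A" "\<delta> \<lless> d a b"
        using subsetD[OF B b] by (auto simp: robust_ball_def open_ball_def)
      moreover from this have "d a b \<in> scott_closure {d a b | a. a \<in> A}"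
        using scott_closure_subset[of "{d a b | a. a \<in> A}"] by blast
      ultimately show ?thesis
        using scott_closed_downset[OF scott_closure_closed] way_below_imp_le by blast
    qed
    then have "principal \<delta> \<le> scott_hausdorff d A B"
      by (simp add: principal_le_iff scott_hausdorff.rep_eq)
    then have "E \<lless> scott_hausdorff d A B"
      using way_below_le_trans[OF F(1)] \<delta>(2) order_trans by blast
    moreover have "B \<subseteq> X" using B by (auto simp: robust_ball_def open_ball_def)
    ultimately show ?thesis by (simp add: open_ball_def)
  qed
  with \<delta>(1) show ?thesis by blast
qed

text \<open>Distances from points of \<open>A\<close> need only approximate
  \<open>\<epsilon>\<close>, because of the closure; shrinking \<open>\<epsilon>\<close> to
  \<open>\<delta>\<close> yields an actual point of \<open>A\<close>.\<close>

lemma open_ball_principal_subset_Pow_robust_ball: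
  assumes "\<delta> \<lless> \<epsilon>"
  shows "open_ball (Pow X) (scott_hausdorff d) A (principal \<epsilon>) \<subseteq> Pow (robust_ball X d A \<delta>)"
proof
  fix B assume "B \<in> open_ball (Pow X) (scott_hausdorff d) A (principal \<epsilon>)"
  then have BX: "B \<subseteq> X" and "principal \<epsilon> \<le> scott_hausdorff d A B"
    by (auto simp: open_ball_def intro: way_below_imp_le)
  then have *: "\<epsilon> \<in> scott_closure {d a b | a. a \<in> A}" if "b \<in> B" for b
    using that by (auto simp: principal_le_iff scott_hausdorff.rep_eq)
  have "b \<in> robust_ball X d A \<delta>" if "b \<in> B" for b
    using scott_closure_meets_way_above[OF *[OF that] assms] BX that
    by (auto simp: robust_ball_def open_ball_def)
  then show "B \<in> Pow (robust_ball X d A \<delta>)" by blast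
qed

theorem theorem66:
  fixes X :: "'x set" and d :: "'x \<Rightarrow> 'x \<Rightarrow> 'q::continuous_quantale"
  assumes "quantale_metric_on X d"
  shows "robust_topology X d = open_ball_topology (Pow X) (scott_hausdorff d)"
proof -
  let ?d = "scott_hausdorff d"
  let ?\<B> = "{open_ball (Pow X) ?d A E | A E. A \<in> Pow X \<and> E \<lless> 1}"
  have dS: "quantale_metric_on (Pow X) ?d"
    using assms by (rule quantale_metric_on_scott_hausdorff)
  have "openin (robust_topology X d) V" if V: "V \<in> ?\<B>" for V
  proof -
    obtain A E where AE: "A \<in> Pow X" "V = open_ball (Pow X) ?d A E" using V by blast
    have "\<exists>\<delta>. \<delta> \<lless> 1 \<and> Pow (robust_ball X d B \<delta>) \<subseteq> V" if B: "B \<in> V" for B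
    proof -
      \<comment> \<open>\<open>B\<close> need not be the centre \<open>A\<close>, so the ball is
        first recentred at \<open>B\<close>.\<close>
      obtain F where "F \<lless> 1" "open_ball (Pow X) ?d B F \<subseteq> V"
        using open_ball_subset_open_ball[OF dS AE(1)] B unfolding AE(2) by blast
      then show ?thesis
        using Pow_robust_ball_subset_open_ball[of F X d B] by (meson subset_trans)
    qed
    moreover have "V \<subseteq> Pow X" unfolding AE(2) by (auto simp: open_ball_def)
    ultimately show ?thesis by (simp add: openin_robust_topology robust_open_def)
  qed
  \<comment> \<open>The generated topology is the coarsest one in which the balls are open.\<close>
  then have "openin (robust_topology X d) U" if "generate_topology_on ?\<B> U" for U
    using generate_topology_on_coarsest[OF istopology_openin _ that] by blast
  moreover have "openin (open_ball_topology (Pow X) ?d) U" if U: "openin (robust_topology X d) U" for U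
    unfolding openin_subopen[of _ U]
  proof
    fix A assume A: "A \<in> U"
    have R: "robust_open X d U" using U by (simp add: openin_robust_topology)
    have AX: "A \<in> Pow X" using R A by (auto simp: robust_open_def)
    obtain \<delta> where \<delta>: "\<delta> \<lless> 1" "Pow (robust_ball X d A \<delta>) \<subseteq> U"
      using R A by (auto simp: robust_open_def)
    \<comment> \<open>\<open>\<epsilon> \<lless> 1\<close> makes \<open>principal \<epsilon>\<close>
      an admissible radius; \<open>\<delta> \<lless> \<epsilon>\<close> absorbs the closure in
      \<open>scott_hausdorff\<close>.\<close>
    obtain \<epsilon> where \<epsilon>: "\<delta> \<lless> \<epsilon>" "\<epsilon> \<lless> 1" using way_below_interpolate[OF \<delta>(1)] by blast
    have one: "principal \<epsilon> \<lless> 1"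
      using \<epsilon>(2) by (intro principal_way_below[of 1]) (simp_all add: one_scott_closed.rep_eq)
    let ?V = "open_ball (Pow X) ?d A (principal \<epsilon>)"
    have "openin (open_ball_topology (Pow X) ?d) ?V"
      unfolding open_ball_topology_def using AX one by (intro topology_generated_by_Basis) blast
    moreover have "A \<in> ?V" using center_in_open_ball[OF dS AX one] .
    moreover have "?V \<subseteq> U"
      using open_ball_principal_subset_Pow_robust_ball[OF \<epsilon>(1)] \<delta>(2) by (rule subset_trans)
    ultimately show "\<exists>T. openin (open_ball_topology (Pow X) ?d) T \<and> A \<in> T \<and> T \<subseteq> U" by blast
  qed
  ultimately show ?thesis
    by (auto simp: topology_eq open_ball_topology_def openin_topology_generated_by_iff)
qed

end
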